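(* Let $p\in\mathbb{Z}^+$ have prime factorization $p=p_1^{\alpha_1}p_2^{\alpha_2}\cdots p_s^{\alpha_s}$ with $s>1$ (the $p_i$ distinct primes, $\alpha_i\ge1$), let $I_1,I_2$ be any partition of $\{1,\ldots,s\}$, and put $q_1=\prod_{i\in I_1}p_i^{\alpha_i}$ and $q_2=\prod_{i\in I_2}p_i^{\alpha_i}$. Then, for $0<\varepsilon\le\frac12$, the language $L(p)=\{a^{kp}\mid k\in\mathbb{Z}^+\}$ over the alphabet $\{a\}$ can be recognized with one-sided error $\varepsilon$ by a 1QCFA $\mathcal{A}(q_1,q_2,\varepsilon)$ with $O(\log q_1)=O\!\left(\sum_{i\in I_1}\alpha_i\log p_i\right)$ quantum basis states and $O(q_2)=O\!\left(\prod_{i\in I_2}p_i^{\alpha_i}\right)$ classical states.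
   Context: A partition $I_1,I_2$ of $\{1,\dots,s\}$ means two disjoint nonempty sets with union $\{1,\dots,s\}$. The constants implicit in $O(\cdot)$ may depend on $\varepsilon$, but not on $p$ or on the partition. 1QCFA (one-way finite automaton with quantum and classical states, measure-once version): it has a finite set $Q$ of orthonormal quantum basis states spanning a Hilbert space $H(Q)$, a finite set $S$ of classical states (containing disjoint sets $S_{acc}$, $S_{rej}$ of accepting and rejecting states), an initial quantum state $|q_0\rangle\in Q$, an initial classical state $s_0\in S$, and an input alphabet $\Sigma$ extended by a left end-marker and a right end-marker. On input $w$ the tape contains $w$ between the two end-markers, and the head scans the tape once from left to right, starting at the left end-marker. At each step, if the classical state is $s$ and the scanned symbol is $\sigma$, a unitary operation $\Theta(s,\sigma)$ on $H(Q)$ is applied to the current quantum state, the classical state is updated to $\delta(s,\sigma)$, and the head moves one cell right. After the right end-marker is scanned, a projective measurement (depending on the classical state) is performed on the quantum state, and the current classical state and the measurement outcome determine the final classical state, which is accepting or rejecting. The number of quantum basis states is $|Q|=\dim H(Q)$; the number of classical states is $|S|$. $\mathcal{A}$ recognizes $L\subset\Sigma^*$ with one-sided error $\varepsilon$ (where $0<\varepsilon\le\frac12$) if $\Pr[\mathcal{A}\text{ accepts }w]=1$ for all $w\in L$, and $\Pr[\mathcal{A}\text{ rejects }w]\ge 1-\varepsilon$ for all $w\in\Sigma^*\setminus L$. *)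

theory Defs
  imports
    "Jordan_Normal_Form.Schur_Decomposition"
    "HOL-Computational_Algebra.Primes"
begin

definition unitary_op :: "nat \<Rightarrow> complex mat \<Rightarrow> bool" where
  "unitary_op n U \<longleftrightarrow>
     U \<in> carrier_mat n n \<and> mat_adjoint U * U = 1\<^sub>m n \<and> U * mat_adjoint U = 1\<^sub>m n"

(* A projective measurement is the list of its projectors; the outcome is the list index. *)
definition projective_measurement :: "nat \<Rightarrow> complex mat list \<Rightarrow> bool" where
  "projective_measurement n Ps \<longleftrightarrow>
     (\<forall>P\<in>set Ps. P \<in> carrier_mat n n \<and> mat_adjoint P = P \<and> P * P = P) \<and>
     (\<forall>c<length Ps. \<forall>d<length Ps. c \<noteq> d \<longrightarrow> Ps ! c * Ps ! d = 0\<^sub>m n n) \<and>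
     mat n n (\<lambda>(i, j). \<Sum>c<length Ps. (Ps ! c) $$ (i, j)) = 1\<^sub>m n"

definition outcome_prob :: "complex mat \<Rightarrow> complex vec \<Rightarrow> real" where
  "outcome_prob P \<psi> = Re ((P *\<^sub>v \<psi>) \<bullet>c (P *\<^sub>v \<psi>))"

datatype 'a tape_symbol = LeftEnd | Letter 'a | RightEnd

(* The quantum basis states are the standard unit vectors of C^n with n = qdim, so that
   qdim is their number.  qcfa_final s c is the final classical state for the
   classical state s reached after the right end-marker and the measurement outcome c. *)
record ('s, 'a) qcfa =
  qdim :: nat
  qinit :: nat
  cstates :: "'s set"
  acc_states :: "'s set"
  rej_states :: "'s set"
  cinit :: 's
  alphabet :: "'a set"
  qcfa_op :: "'s \<Rightarrow> 'a tape_symbol \<Rightarrow> complex mat"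
  qcfa_next :: "'s \<Rightarrow> 'a tape_symbol \<Rightarrow> 's"
  qcfa_meas :: "'s \<Rightarrow> complex mat list"
  qcfa_final :: "'s \<Rightarrow> nat \<Rightarrow> 's"

definition tape_alphabet :: "('s, 'a) qcfa \<Rightarrow> 'a tape_symbol set" where
  "tape_alphabet A = {LeftEnd, RightEnd} \<union> Letter ` alphabet A"

definition is_1qcfa :: "('s, 'a) qcfa \<Rightarrow> bool" where
  "is_1qcfa A \<longleftrightarrow>
     qinit A < qdim A \<and>
     finite (cstates A) \<and> cinit A \<in> cstates A \<and>
     acc_states A \<subseteq> cstates A \<and> rej_states A \<subseteq> cstates A \<and>
     acc_states A \<inter> rej_states A = {} \<and>
     finite (alphabet A) \<and>
     (\<forall>s\<in>cstates A. \<forall>\<sigma>\<in>tape_alphabet A.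
        unitary_op (qdim A) (qcfa_op A s \<sigma>) \<and> qcfa_next A s \<sigma> \<in> cstates A) \<and>
     (\<forall>s\<in>cstates A. projective_measurement (qdim A) (qcfa_meas A s)) \<and>
     (\<forall>s\<in>cstates A. \<forall>c<length (qcfa_meas A s).
        qcfa_final A s c \<in> acc_states A \<union> rej_states A)"

definition qcfa_step ::
  "('s, 'a) qcfa \<Rightarrow> 's \<times> complex vec \<Rightarrow> 'a tape_symbol \<Rightarrow> 's \<times> complex vec" where
  "qcfa_step A = (\<lambda>(s, \<psi>) \<sigma>. (qcfa_next A s \<sigma>, qcfa_op A s \<sigma> *\<^sub>v \<psi>))"

definition qcfa_run :: "('s, 'a) qcfa \<Rightarrow> 'a list \<Rightarrow> 's \<times> complex vec" where
  "qcfa_run A w =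
     foldl (qcfa_step A) (cinit A, unit_vec (qdim A) (qinit A))
       (LeftEnd # map Letter w @ [RightEnd])"

definition final_prob :: "('s, 'a) qcfa \<Rightarrow> 's set \<Rightarrow> 'a list \<Rightarrow> real" where
  "final_prob A F w =
     (case qcfa_run A w of (s, \<psi>) \<Rightarrow>
       (\<Sum>c | c < length (qcfa_meas A s) \<and> qcfa_final A s c \<in> F.
          outcome_prob (qcfa_meas A s ! c) \<psi>))"

definition prob_accepts :: "('s, 'a) qcfa \<Rightarrow> 'a list \<Rightarrow> real" where
  "prob_accepts A w = final_prob A (acc_states A) w"

definition prob_rejects :: "('s, 'a) qcfa \<Rightarrow> 'a list \<Rightarrow> real" where
  "prob_rejects A w = final_prob A (rej_states A) w"

definition recognizes_one_sided :: "('s, 'a) qcfa \<Rightarrow> 'a list set \<Rightarrow> real \<Rightarrow> bool" where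
  "recognizes_one_sided A L \<epsilon> \<longleftrightarrow>
     L \<subseteq> lists (alphabet A) \<and>
     (\<forall>w\<in>L. prob_accepts A w = 1) \<and>
     (\<forall>w\<in>lists (alphabet A) - L. prob_rejects A w \<ge> 1 - \<epsilon>)"

(* k ranges over the positive integers, so the empty word is not in the language. *)
definition mult_lang :: "'a \<Rightarrow> nat \<Rightarrow> 'a list set" where
  "mult_lang a p = {replicate (k * p) a | k. k \<ge> 1}"

end

theory Submission
  imports Defs
begin

text \<open>The classical states count the length \<open>n\<close> of the input modulo \<open>q2\<close>, so the quantum register only
  has to tell whether \<open>q1\<close> divides \<open>n\<close>.  It is a uniform superposition of \<open>m\<close> basis states (up to a
  fixed unitary), the \<open>l\<close>-th of which picks up the phase \<open>cis (2 * pi * k l / q1)\<close> per letter; the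
  probability of finding it unchanged is the squared modulus of the average of
  \<open>cis (2 * pi * k l * n / q1)\<close>.  This is 1 if \<open>q1\<close> divides \<open>n\<close>, and by a Chernoff bound together with
  a union bound over the residues of \<open>n\<close> some choice of \<open>m = O(ln q1)\<close> multipliers makes it at most
  \<open>\<epsilon>\<close> for all other \<open>n\<close>.\<close>

section \<open>Exponential sums\<close>

lemma cis_eq_1_imp_Ints:
  assumes "cis (2 * pi * x) = 1"
  shows "x \<in> \<int>"
proof -
  have "cos (2 * pi * x) = 1"
    using assms by (metis cis.sel(1) one_complex.sel(1))
  then obtain n :: int where "2 * pi * x = real_of_int n * 2 * pi"
    unfolding cos_one_2pi_int by auto
  then have "x = real_of_int n" by simp
  then show ?thesis by simp
qed

text \<open>A geometric sum whose ratio \<open>z\<close> is a \<open>q\<close>-th root of unity,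
  equal to 1 exactly when \<open>q\<close> divides \<open>r\<close>. It is used twice: the phases
  have mean zero over all multipliers, and the Fourier columns are orthogonal. The latter needs
  negative \<open>r\<close>, hence the integer type.\<close>

lemma sum_cis_multiples:
  fixes r :: int and q :: nat
  assumes "q > 0"
  shows "(\<Sum>k<q. cis (2 * pi * real k * real_of_int r / real q)) = (if int q dvd r then of_nat q else 0)"
proof -
  define z where "z = cis (2 * pi * (real_of_int r / real q))"
  have pow: "cis (2 * pi * real k * real_of_int r / real q) = z ^ k" for k
    unfolding z_def DeMoivre by (simp add: mult_ac)
  show ?thesis
  proof (cases "int q dvd r")
    case True
    then obtain m where "r = int q * m" by auto
    then have "z = 1" unfolding z_def using assms by simp
    then show ?thesis using True by (simp add: pow)
  next
    case False
    have "z \<noteq> 1"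
    proof
      assume "z = 1"
      then obtain m where "real_of_int r / real q = real_of_int m"
        unfolding z_def by (metis cis_eq_1_imp_Ints Ints_cases)
      then have "real_of_int r = real_of_int (m * int q)" using assms by (simp add: field_simps)
      then have "r = m * int q" by (simp only: of_int_eq_iff)
      with False show False by simp
    qed
    moreover have "z ^ q = 1"
      using assms cis_multiple_2pi[of "real_of_int r"] unfolding z_def DeMoivre by simp
    ultimately show ?thesis using False by (simp add: pow geometric_sum)
  qed
qed

section \<open>Chernoff bound for the phases\<close>

lemma exp_le_quadratic:
  fixes y :: real
  assumes "\<bar>y\<bar> \<le> 1"
  shows "exp y \<le> 1 + y + y\<^sup>2"
proof (cases "y \<ge> 0")
  case True
  then show ?thesis using assms exp_bound[of y] by simp
next
  case False
  define x where "x = - y"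
  have x: "0 < x" using False by (simp add: x_def)
  have "exp y = 1 / exp x" by (simp add: x_def exp_minus field_simps)
  also have "\<dots> \<le> 1 / (1 + x)"
    using x exp_ge_add_one_self[of x] by (intro divide_left_mono) auto
  also have "\<dots> \<le> 1 - x + x\<^sup>2"
  proof -
    \<comment> \<open>The product is \<open>1 + x^3\<close>.\<close>
    have "1 \<le> (1 - x + x\<^sup>2) * (1 + x)"
      using x zero_le_power[of x 3] by (simp add: algebra_simps power2_eq_square power3_eq_cube)
    then show ?thesis using x by (simp add: divide_le_eq)
  qed
  finally show ?thesis by (simp add: x_def)
qed

text \<open>Bound on the moment generating function: in the quadratic estimate of
  \<open>exp\<close>, the linear term cancels on summation because the mean is zero.\<close>

lemma sum_exp_le_of_sum_zero:
  fixes x :: "'k \<Rightarrow> real"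
  assumes "\<And>k. k \<in> K \<Longrightarrow> \<bar>x k\<bar> \<le> 1" and "(\<Sum>k\<in>K. x k) = 0"
    and t: "0 \<le> t" "t \<le> 1"
  shows "(\<Sum>k\<in>K. exp (t * x k)) \<le> real (card K) * exp (t\<^sup>2)"
proof -
  have "(\<Sum>k\<in>K. exp (t * x k)) \<le> (\<Sum>k\<in>K. (1 + t\<^sup>2) + t * x k)"
  proof (rule sum_mono)
    fix k assume k: "k \<in> K"
    have le: "\<bar>t * x k\<bar> \<le> 1"
      using mult_mono[of t 1 "\<bar>x k\<bar>" 1] assms(1)[OF k] t by (simp add: abs_mult)
    have "(x k)\<^sup>2 \<le> 1" using assms(1)[OF k] by (simp add: abs_square_le_1)
    then have "(t * x k)\<^sup>2 \<le> t\<^sup>2" by (simp add: power_mult_distrib mult_left_le)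
    then show "exp (t * x k) \<le> (1 + t\<^sup>2) + t * x k"
      using exp_le_quadratic[OF le] by simp
  qed
  also have "\<dots> = real (card K) * (1 + t\<^sup>2)"
    using assms(2) by (simp add: sum.distrib flip: sum_distrib_left)
  also have "\<dots> \<le> real (card K) * exp (t\<^sup>2)"
    by (intro mult_left_mono) (use exp_ge_add_one_self[of "t\<^sup>2"] in auto)
  finally show ?thesis .
qed

text \<open>Derandomised Chernoff bound: some choice of the next entry is at least as good as the average.\<close>

lemma exists_list_sum_exp_le:
  fixes x :: "'i \<Rightarrow> 'k \<Rightarrow> real"
  assumes K: "finite K" "K \<noteq> {}"
    and x: "\<And>i k. i \<in> I \<Longrightarrow> k \<in> K \<Longrightarrow> \<bar>x i k\<bar> \<le> 1"
    and zero: "\<And>i. i \<in> I \<Longrightarrow> (\<Sum>k\<in>K. x i k) = 0"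
    and t: "0 \<le> t" "t \<le> 1"
  shows "\<exists>ks. length ks = m \<and>
           (\<Sum>i\<in>I. exp (t * (\<Sum>k\<leftarrow>ks. x i k))) \<le> real (card I) * exp (real m * t\<^sup>2)"
proof (induction m)
  case 0
  show ?case by simp
next
  case (Suc m)
  then obtain ks where ks: "length ks = m"
    "(\<Sum>i\<in>I. exp (t * (\<Sum>k\<leftarrow>ks. x i k))) \<le> real (card I) * exp (real m * t\<^sup>2)" by auto
  define S where "S i = exp (t * (\<Sum>k\<leftarrow>ks. x i k))" for i
  have "(\<Sum>k\<in>K. \<Sum>i\<in>I. exp (t * x i k) * S i) = (\<Sum>i\<in>I. (\<Sum>k\<in>K. exp (t * x i k)) * S i)"
    by (subst sum.swap) (simp add: sum_distrib_right)
  also have "\<dots> \<le> (\<Sum>i\<in>I. (real (card K) * exp (t\<^sup>2)) * S i)"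
    by (intro sum_mono mult_right_mono sum_exp_le_of_sum_zero x zero t) (auto simp: S_def)
  also have "\<dots> = (\<Sum>k\<in>K. exp (t\<^sup>2) * (\<Sum>i\<in>I. S i))"
    by (simp add: mult_ac flip: sum_distrib_right)
  \<comment> \<open>Averaging: if every \<open>k\<close> exceeded the right-hand side, summing over
    the nonempty \<open>K\<close> would contradict the inequality just obtained.\<close>
  finally have "\<exists>k\<in>K. (\<Sum>i\<in>I. exp (t * x i k) * S i) \<le> exp (t\<^sup>2) * (\<Sum>i\<in>I. S i)"
    using sum_strict_mono[OF K, of "\<lambda>_. exp (t\<^sup>2) * (\<Sum>i\<in>I. S i)"
        "\<lambda>k. \<Sum>i\<in>I. exp (t * x i k) * S i"]
    by (meson not_le)
  then obtain k where k: "(\<Sum>i\<in>I. exp (t * x i k) * S i) \<le> exp (t\<^sup>2) * (\<Sum>i\<in>I. S i)" by blast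
  have "(\<Sum>i\<in>I. exp (t * (\<Sum>k\<leftarrow>k # ks. x i k))) = (\<Sum>i\<in>I. exp (t * x i k) * S i)"
    by (simp add: S_def distrib_left exp_add)
  also note k
  also have "exp (t\<^sup>2) * (\<Sum>i\<in>I. S i) \<le> exp (t\<^sup>2) * (real (card I) * exp (real m * t\<^sup>2))"
    using ks(2) by (intro mult_left_mono) (auto simp: S_def)
  also have "\<dots> = real (card I) * exp (real (Suc m) * t\<^sup>2)"
    by (simp add: distrib_right exp_add)
  finally show ?case using ks(1) by (intro exI[of _ "k # ks"]) auto
qed

lemma Re_sum_list: "Re (\<Sum>k\<leftarrow>ks. f k) = (\<Sum>k\<leftarrow>ks. Re (f k))"
  by (induction ks) auto

text \<open>Reduces all lengths \<open>n\<close> to finitely many residues, over which a union bound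
  is possible.\<close>

lemma cis_mod_nat:
  fixes q k n :: nat
  assumes "q > 0"
  shows "cis (2 * pi * real k * real (n mod q) / real q) = cis (2 * pi * real k * real n / real q)"
proof -
  have "real n = real q * real (n div q) + real (n mod q)"
    by (metis mult_div_mod_eq of_nat_add of_nat_mult)
  then have "2 * pi * real k * real n / real q =
      2 * pi * real (k * (n div q)) + 2 * pi * real k * real (n mod q) / real q"
    using assms by (simp add: field_simps)
  then show ?thesis by (simp flip: cis_mult)
qed

text \<open>The total of the exponential moments over all residues and directions is smaller than
  what a single large deviation would contribute, so no residue deviates.\<close>

lemma exists_small_exponential_sums:
  fixes q m :: nat and \<delta> :: real
  assumes q: "q \<ge> 2" and \<delta>: "0 < \<delta>" "\<delta> \<le> 1" and m: "4 * ln (4 * real q) / \<delta>\<^sup>2 \<le> real m"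
  shows "\<exists>ks. length ks = m \<and> (\<forall>n. \<not> q dvd n \<longrightarrow>
           (cmod (\<Sum>k\<leftarrow>ks. cis (2 * pi * real k * real n / real q)))\<^sup>2 \<le> 2 * (\<delta> * real m)\<^sup>2)"
proof -
  \<comment> \<open>Nonzero residues paired with four directions: the real parts of
    \<open>c * z\<close> for these \<open>c\<close> are \<open>Re z\<close>, \<open>- Re z\<close>,
    \<open>- Im z\<close> and \<open>Im z\<close>, so one-sided real bounds control a complex
    sum.\<close>
  define I where "I = {1..<q} \<times> {1, -1, \<i>, -\<i>}"
  define x where "x = (\<lambda>(n, c) k. Re (c * cis (2 * pi * real k * real n / real q)))"
  \<comment> \<open>This \<open>t\<close> maximises \<open>t * \<delta> - t^2\<close>, with value
    \<open>\<delta>^2 / 4\<close>; the lower bound on \<open>m\<close> is what then absorbs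
    \<open>ln (4 * q)\<close>.\<close>
  define t where "t = \<delta> / 2"
  have "\<exists>ks. length ks = m \<and>
      (\<Sum>i\<in>I. exp (t * (\<Sum>k\<leftarrow>ks. x i k))) \<le> real (card I) * exp (real m * t\<^sup>2)"
  proof (rule exists_list_sum_exp_le[where K = "{..<q}"])
    fix i :: "nat \<times> complex" and k :: nat
    assume "i \<in> I"
    then obtain n c where i: "i = (n, c)" and "cmod c = 1" by (auto simp: I_def)
    then show "\<bar>x i k\<bar> \<le> 1"
      using abs_Re_le_cmod[of "c * cis (2 * pi * real k * real n / real q)"]
      by (simp add: x_def norm_mult)
  next
    fix i :: "nat \<times> complex"
    assume "i \<in> I"
    then obtain n c where i: "i = (n, c)" and n: "1 \<le> n" "n < q" by (auto simp: I_def)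
    have "\<not> int q dvd int n" using n by (auto dest: dvd_imp_le)
    then have "(\<Sum>k<q. cis (2 * pi * real k * real n / real q)) = 0"
      using sum_cis_multiples[of q "int n"] q by simp
    then have "Re (c * (\<Sum>k<q. cis (2 * pi * real k * real n / real q))) = 0" by simp
    then show "(\<Sum>k<q. x i k) = 0"
      by (simp add: i x_def sum_distrib_left)
  qed (use q \<delta> in \<open>auto simp: t_def lessThan_empty_iff\<close>)
  then obtain ks where ks: "length ks = m"
    and bound: "(\<Sum>i\<in>I. exp (t * (\<Sum>k\<leftarrow>ks. x i k))) \<le> real (card I) * exp (real m * t\<^sup>2)"
    by blast
  have finI: "finite I" by (simp add: I_def)
  have "card I \<le> card {1..<q} * 4"
    unfolding I_def card_cartesian_product
    by (intro mult_left_mono order.trans[OF card_insert_le_m1]) (auto simp: card_insert_if)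
  then have cardI: "real (card I) \<le> 4 * real q" by simp
  have exponent: "ln (4 * real q) + real m * t\<^sup>2 \<le> t * (\<delta> * real m)"
    using m \<delta> by (simp add: t_def field_simps power2_eq_square)
  have le: "Re (c * (\<Sum>k\<leftarrow>ks. cis (2 * pi * real k * real n / real q))) \<le> \<delta> * real m"
    if "(n, c) \<in> I" for n c
  proof -
    have eq: "(\<Sum>k\<leftarrow>ks. x (n, c) k) =
        Re (c * (\<Sum>k\<leftarrow>ks. cis (2 * pi * real k * real n / real q)))"
      by (simp add: x_def Re_sum_list flip: sum_list_const_mult)
    \<comment> \<open>Union bound: all summands are positive, so each one is at most the
      total.\<close>
    have "exp (t * (\<Sum>k\<leftarrow>ks. x (n, c) k)) \<le> (\<Sum>i\<in>I. exp (t * (\<Sum>k\<leftarrow>ks. x i k)))"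
      using member_le_sum[OF that, of "\<lambda>i. exp (t * (\<Sum>k\<leftarrow>ks. x i k))"] finI by simp
    also note bound
    also have "real (card I) * exp (real m * t\<^sup>2) \<le> 4 * real q * exp (real m * t\<^sup>2)"
      using cardI by (intro mult_right_mono) auto
    also have "\<dots> = exp (ln (4 * real q) + real m * t\<^sup>2)"
      using q by (simp add: exp_add)
    also have "\<dots> \<le> exp (t * (\<delta> * real m))" using exponent by simp
    finally show ?thesis using \<delta> by (simp add: eq t_def)
  qed
  have "(cmod (\<Sum>k\<leftarrow>ks. cis (2 * pi * real k * real n / real q)))\<^sup>2 \<le> 2 * (\<delta> * real m)\<^sup>2"
    if n: "\<not> q dvd n" for n
  proof -
    define r where "r = n mod q"
    define z where "z = (\<Sum>k\<leftarrow>ks. cis (2 * pi * real k * real r / real q))"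
    have "r \<in> {1..<q}" using n q by (auto simp: r_def Suc_le_eq dvd_eq_mod_eq_0)
    then have "Re (1 * z) \<le> \<delta> * real m" "Re (-1 * z) \<le> \<delta> * real m"
        "Re (\<i> * z) \<le> \<delta> * real m" "Re (-\<i> * z) \<le> \<delta> * real m"
      unfolding z_def by (intro le; simp add: I_def)+
    \<comment> \<open>Bounding both coordinates separately is the source of the factor 2 in the
      conclusion.\<close>
    then have "\<bar>Re z\<bar> \<le> \<delta> * real m" "\<bar>Im z\<bar> \<le> \<delta> * real m" by auto
    then have "(Re z)\<^sup>2 \<le> (\<delta> * real m)\<^sup>2" "(Im z)\<^sup>2 \<le> (\<delta> * real m)\<^sup>2"
      using abs_le_square_iff by fastforce+
    then have "(cmod z)\<^sup>2 \<le> 2 * (\<delta> * real m)\<^sup>2" by (simp add: cmod_power2)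
    then show ?thesis using q by (simp add: z_def r_def cis_mod_nat)
  qed
  then show ?thesis using ks by blast
qed

section \<open>The quantum part\<close>

lemma mat_adjoint_index:
  fixes A :: "complex mat"
  assumes "A \<in> carrier_mat n n" "i < n" "j < n"
  shows "mat_adjoint A $$ (i, j) = cnj (A $$ (j, i))"
  using assms by (simp add: mat_adjoint_def mat_of_rows_def)

text \<open>Conjugating the diagonal matrix of the phases \<open>cis (\<theta> * \<kappa> l)\<close> by the Fourier matrix gives
  a one-parameter unitary group whose (0,0) entry is the average of the phases.\<close>

definition rot :: "nat \<Rightarrow> (nat \<Rightarrow> real) \<Rightarrow> real \<Rightarrow> complex mat" where
  "rot d \<kappa> \<theta> = mat d d (\<lambda>(i, j).
     (\<Sum>l<d. cis (2 * pi * real l * (real j - real i) / real d + \<theta> * \<kappa> l)) / of_nat d)"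

lemma rot_carrier [simp]: "rot d \<kappa> \<theta> \<in> carrier_mat d d"
  by (simp add: rot_def)

lemma rot_dim [simp]: "dim_row (rot d \<kappa> \<theta>) = d" "dim_col (rot d \<kappa> \<theta>) = d"
  by (simp_all add: rot_def)

text \<open>Orthogonality of the Fourier columns: \<open>l\<close> and \<open>m\<close> differ by
  less than \<open>d\<close>, so \<open>d\<close> divides the difference only if it is zero.\<close>

lemma sum_cis_diff:
  assumes "l < d" "m < d"
  shows "(\<Sum>k<d. cis (2 * pi * real k * (real l - real m) / real d)) = (if l = m then of_nat d else 0)"
proof -
  have "int d dvd (int l - int m) \<longleftrightarrow> l = m"
    using assms by (auto dest: zdvd_imp_le[rotated] simp flip: mod_eq_dvd_iff)
  then show ?thesis
    using sum_cis_multiples[of d "int l - int m"] assms by auto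
qed

lemma rot_0: "rot d \<kappa> 0 = 1\<^sub>m d"
proof (rule eq_matI)
  fix i j assume "i < dim_row (1\<^sub>m d)" "j < dim_col (1\<^sub>m d)"
  then have "i < d" "j < d" by auto
  then show "rot d \<kappa> 0 $$ (i, j) = 1\<^sub>m d $$ (i, j)"
    using sum_cis_diff[of j d i] by (auto simp: rot_def)
qed auto

text \<open>Summing over the inner index \<open>k\<close> of the product leaves only the terms with
  \<open>l = m\<close>, by Fourier orthogonality; there the two phases of the same \<open>l\<close>
  multiply.\<close>

lemma rot_add: "rot d \<kappa> \<theta> * rot d \<kappa> \<phi> = rot d \<kappa> (\<theta> + \<phi>)"
proof (rule eq_matI)
  fix i j assume "i < dim_row (rot d \<kappa> (\<theta> + \<phi>))" "j < dim_col (rot d \<kappa> (\<theta> + \<phi>))"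
  then have ij: "i < d" "j < d" by auto
  then have d: "d > 0" by simp
  \<comment> \<open>\<open>f\<close> and \<open>g\<close> collect the factors free of
    \<open>k\<close>, so that \<open>k\<close> occurs only in the Fourier factor.\<close>
  define f where "f l = cis (\<theta> * \<kappa> l - 2 * pi * real l * real i / real d)" for l
  define g where "g l = cis (\<phi> * \<kappa> l + 2 * pi * real l * real j / real d)" for l
  have split: "cis (2 * pi * real l * (real k - real i) / real d + \<theta> * \<kappa> l) *
      cis (2 * pi * real m * (real j - real k) / real d + \<phi> * \<kappa> m) =
      f l * g m * cis (2 * pi * real k * (real l - real m) / real d)" for k l m
    by (simp add: f_def g_def cis_mult) (simp add: field_simps diff_divide_distrib)
  have "(rot d \<kappa> \<theta> * rot d \<kappa> \<phi>) $$ (i, j) = (\<Sum>k<d. rot d \<kappa> \<theta> $$ (i, k) * rot d \<kappa> \<phi> $$ (k, j))"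
    using ij by (simp add: scalar_prod_def atLeast0LessThan)
  also have "\<dots> = (\<Sum>k<d. \<Sum>l<d. \<Sum>m<d.
      f l * g m * cis (2 * pi * real k * (real l - real m) / real d)) / (of_nat d)\<^sup>2"
    using ij by (simp add: rot_def sum_product split power2_eq_square flip: sum_divide_distrib)
  also have "(\<Sum>k<d. \<Sum>l<d. \<Sum>m<d. f l * g m * cis (2 * pi * real k * (real l - real m) / real d)) =
      (\<Sum>l<d. \<Sum>k<d. \<Sum>m<d. f l * g m * cis (2 * pi * real k * (real l - real m) / real d))"
    by (rule sum.swap)
  also have "\<dots> = (\<Sum>l<d. \<Sum>m<d. \<Sum>k<d. f l * g m * cis (2 * pi * real k * (real l - real m) / real d))"
    by (intro sum.cong refl sum.swap)
  also have "\<dots> = (\<Sum>l<d. \<Sum>m<d. f l * g m * (if l = m then of_nat d else 0))"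
    by (intro sum.cong refl) (simp add: sum_cis_diff flip: sum_distrib_left)
  also have "\<dots> = (\<Sum>l<d. f l * g l) * of_nat d"
    by (simp add: if_distrib[of "(*) _"] sum_distrib_right cong: if_cong)
  also have "\<dots> / (of_nat d)\<^sup>2 = (\<Sum>l<d. f l * g l) / of_nat d"
    using d by (simp add: power2_eq_square)
  also have "(\<Sum>l<d. f l * g l) = (\<Sum>l<d. cis (2 * pi * real l * (real j - real i) / real d + (\<theta> + \<phi>) * \<kappa> l))"
    by (intro sum.cong refl) (simp add: f_def g_def cis_mult, simp add: algebra_simps diff_divide_distrib)
  finally show "(rot d \<kappa> \<theta> * rot d \<kappa> \<phi>) $$ (i, j) = rot d \<kappa> (\<theta> + \<phi>) $$ (i, j)"
    using ij by (simp add: rot_def)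
qed auto

text \<open>Conjugation negates the whole argument and transposition swaps \<open>i\<close> and
  \<open>j\<close>, which restores the Fourier part and leaves only \<open>\<theta>\<close> negated.
  With \<open>rot_add\<close> and \<open>rot_0\<close> this yields unitarity.\<close>

lemma rot_adjoint: "mat_adjoint (rot d \<kappa> \<theta>) = rot d \<kappa> (- \<theta>)"
proof (rule eq_matI)
  fix i j assume "i < dim_row (rot d \<kappa> (- \<theta>))" "j < dim_col (rot d \<kappa> (- \<theta>))"
  then have ij: "i < d" "j < d" by auto
  have eq: "- (2 * pi * real l * (real i - real j) / real d + \<theta> * \<kappa> l) =
      2 * pi * real l * (real j - real i) / real d + - \<theta> * \<kappa> l" for l
    by (simp add: algebra_simps diff_divide_distrib)
  have "mat_adjoint (rot d \<kappa> \<theta>) $$ (i, j) = cnj (rot d \<kappa> \<theta> $$ (j, i))"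
    using ij by (intro mat_adjoint_index) auto
  also have "\<dots> = rot d \<kappa> (- \<theta>) $$ (i, j)"
    using ij by (simp only: rot_def index_mat prod.case complex_cnj_divide cnj_sum cis_cnj eq
        complex_cnj_of_nat)
  finally show "mat_adjoint (rot d \<kappa> \<theta>) $$ (i, j) = rot d \<kappa> (- \<theta>) $$ (i, j)" .
qed (auto simp: mat_adjoint_def)

lemma unitary_rot: "unitary_op d (rot d \<kappa> \<theta>)"
  by (simp add: unitary_op_def rot_adjoint rot_add rot_0)

section \<open>Measurement in the standard basis\<close>

definition coord_proj :: "nat \<Rightarrow> nat set \<Rightarrow> complex mat" where
  "coord_proj n S = mat n n (\<lambda>(i, j). if i = j \<and> i \<in> S then 1 else 0)"

lemma coord_proj_carrier [simp]: "coord_proj n S \<in> carrier_mat n n"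
  by (simp add: coord_proj_def)

lemma coord_proj_mult: "coord_proj n S * coord_proj n T = coord_proj n (S \<inter> T)"
proof (rule eq_matI)
  fix i j assume "i < dim_row (coord_proj n (S \<inter> T))" "j < dim_col (coord_proj n (S \<inter> T))"
  then have ij: "i < n" "j < n" by (auto simp: coord_proj_def)
  have "(coord_proj n S * coord_proj n T) $$ (i, j) =
      (\<Sum>k<n. coord_proj n S $$ (i, k) * coord_proj n T $$ (k, j))"
    using ij by (simp add: scalar_prod_def atLeast0LessThan coord_proj_def)
  also have "\<dots> = (\<Sum>k<n. if k = i then if i = j \<and> i \<in> S \<inter> T then 1 else 0 else 0)"
    using ij by (intro sum.cong) (auto simp: coord_proj_def)
  finally show "(coord_proj n S * coord_proj n T) $$ (i, j) = coord_proj n (S \<inter> T) $$ (i, j)"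
    using ij by (simp add: coord_proj_def)
qed (auto simp: coord_proj_def)

lemma coord_proj_adjoint: "mat_adjoint (coord_proj n S) = coord_proj n S"
proof (rule eq_matI)
  fix i j assume "i < dim_row (coord_proj n S)" "j < dim_col (coord_proj n S)"
  then have "i < n" "j < n" by (auto simp: coord_proj_def)
  then show "mat_adjoint (coord_proj n S) $$ (i, j) = coord_proj n S $$ (i, j)"
    by (subst mat_adjoint_index[OF coord_proj_carrier]) (auto simp: coord_proj_def)
qed (auto simp: mat_adjoint_def coord_proj_def)

lemma projective_measurement_coord_proj:
  "projective_measurement n [coord_proj n S, coord_proj n (- S)]"
proof -
  have "mat n n (\<lambda>(i, j). \<Sum>c<2. ([coord_proj n S, coord_proj n (- S)] ! c) $$ (i, j)) = 1\<^sub>m n"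
    by (rule eq_matI) (auto simp: coord_proj_def numeral_2_eq_2)
  moreover have "coord_proj n {} = 0\<^sub>m n n"
    by (rule eq_matI) (auto simp: coord_proj_def)
  ultimately show ?thesis
    by (auto simp: projective_measurement_def coord_proj_adjoint coord_proj_mult numeral_2_eq_2
        less_Suc_eq)
qed

lemma outcome_prob_coord_proj:
  assumes "\<psi> \<in> carrier_vec n"
  shows "outcome_prob (coord_proj n S) \<psi> = (\<Sum>i\<in>{..<n} \<inter> S. (cmod (\<psi> $ i))\<^sup>2)"
proof -
  have "(coord_proj n S *\<^sub>v \<psi>) $ i = (if i \<in> S then \<psi> $ i else 0)" if "i < n" for i
  proof -
    have "(coord_proj n S *\<^sub>v \<psi>) $ i = (\<Sum>k<n. coord_proj n S $$ (i, k) * \<psi> $ k)"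
      using assms that by (simp add: scalar_prod_def atLeast0LessThan coord_proj_def)
    also have "\<dots> = (\<Sum>k<n. if k = i then if i \<in> S then \<psi> $ i else 0 else 0)"
      using that by (intro sum.cong) (auto simp: coord_proj_def)
    finally show ?thesis using that by simp
  qed
  then have "(coord_proj n S *\<^sub>v \<psi>) \<bullet>c (coord_proj n S *\<^sub>v \<psi>) =
      (\<Sum>i<n. if i \<in> S then complex_of_real ((cmod (\<psi> $ i))\<^sup>2) else 0)"
    using assms
    by (auto simp: scalar_prod_def atLeast0LessThan coord_proj_def complex_norm_square
        simp del: of_real_power intro!: sum.cong)
  also have "\<dots> = complex_of_real (\<Sum>i\<in>{..<n} \<inter> S. (cmod (\<psi> $ i))\<^sup>2)"
    by (simp add: sum.inter_restrict of_real_sum) (intro sum.cong; simp)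
  finally show ?thesis by (simp add: outcome_prob_def)
qed

text \<open>The squared norm of column 0 is the (0,0) entry of \<open>mat_adjoint U * U = 1\<close>
  for the unitary \<open>U = rot d \<kappa> \<theta>\<close>. It makes the two outcome probabilities
  add up to 1.\<close>

lemma unit_norm_rot_col:
  assumes "d > 0"
  shows "(\<Sum>i<d. (cmod (rot d \<kappa> \<theta> $$ (i, 0)))\<^sup>2) = 1"
proof -
  have "complex_of_real (\<Sum>i<d. (cmod (rot d \<kappa> \<theta> $$ (i, 0)))\<^sup>2) =
      (\<Sum>i<d. mat_adjoint (rot d \<kappa> \<theta>) $$ (0, i) * rot d \<kappa> \<theta> $$ (i, 0))"
    using assms
    by (simp add: mat_adjoint_index[OF rot_carrier] complex_norm_square mult.commute
        del: of_real_power)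
  also have "\<dots> = (mat_adjoint (rot d \<kappa> \<theta>) * rot d \<kappa> \<theta>) $$ (0, 0)"
    using assms by (simp add: scalar_prod_def atLeast0LessThan rot_adjoint)
  also have "\<dots> = 1" using assms by (simp add: rot_adjoint rot_add rot_0)
  finally show ?thesis by (simp only: of_real_eq_1_iff)
qed

section \<open>The automaton\<close>

text \<open>States \<open>0\<close> (nothing read) and \<open>1, \<dots>, q2\<close> (the length read, reduced modulo \<open>q2\<close>
  to a positive representative) are visited; \<open>q2 + 1\<close> accepts and \<open>q2 + 2\<close> rejects.\<close>

definition counter_next :: "nat \<Rightarrow> nat \<Rightarrow> nat" where
  "counter_next q s = (if s < q then Suc s else 1)"

definition counter_state :: "nat \<Rightarrow> nat \<Rightarrow> nat" where
  "counter_state q n = (if n = 0 then 0 else Suc ((n - 1) mod q))"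

text \<open>Acceptance requires both tests to pass: the counter stands at \<open>q2\<close>, and
  outcome 0 finds the register in its initial basis state. The end-markers act trivially.\<close>

definition rot_qcfa :: "'a \<Rightarrow> nat \<Rightarrow> nat \<Rightarrow> (nat \<Rightarrow> real) \<Rightarrow> real \<Rightarrow> (nat, 'a) qcfa" where
  "rot_qcfa a q2 d \<kappa> \<theta> = \<lparr>
     qdim = d, qinit = 0,
     cstates = {..q2 + 2}, acc_states = {q2 + 1}, rej_states = {q2 + 2}, cinit = 0,
     alphabet = {a},
     qcfa_op = (\<lambda>s \<sigma>. case \<sigma> of Letter _ \<Rightarrow> rot d \<kappa> \<theta> | _ \<Rightarrow> 1\<^sub>m d),
     qcfa_next = (\<lambda>s \<sigma>. case \<sigma> of Letter _ \<Rightarrow> counter_next q2 s | _ \<Rightarrow> s),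
     qcfa_meas = (\<lambda>s. [coord_proj d {0}, coord_proj d (- {0})]),
     qcfa_final = (\<lambda>s c. if s = q2 \<and> c = 0 then q2 + 1 else q2 + 2)\<rparr>"

lemma counter_state_Suc:
  assumes "q > 0"
  shows "counter_next q (counter_state q n) = counter_state q (Suc n)"
proof (cases n)
  case 0
  then show ?thesis using assms by (simp add: counter_next_def counter_state_def)
next
  case (Suc m)
  have "m mod q < q" using assms by (rule mod_less_divisor)
  then have "Suc (m mod q) = q \<or> Suc (m mod q) < q" by linarith
  then show ?thesis
    using Suc by (elim disjE) (simp_all add: counter_next_def counter_state_def mod_Suc)
qed

text \<open>Representatives run from 1 to \<open>q\<close> so that positive multiples of
  \<open>q\<close> end in state \<open>q\<close>, while state 0 is kept for the empty word, which is
  not in the language.\<close>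

lemma counter_state_eq_iff:
  assumes "q > 0"
  shows "counter_state q n = q \<longleftrightarrow> n > 0 \<and> q dvd n"
proof (cases n)
  case (Suc m)
  have "m mod q < q" using assms by simp
  then show ?thesis using Suc by (auto simp: counter_state_def mod_Suc dvd_eq_mod_eq_0)
qed (use assms in \<open>simp add: counter_state_def\<close>)

lemma is_1qcfa_rot_qcfa:
  assumes "d > 0"
  shows "is_1qcfa (rot_qcfa a q2 d \<kappa> \<theta>)"
proof -
  have "unitary_op d (1\<^sub>m d)" using unitary_rot[of d \<kappa> 0] by (simp add: rot_0)
  then show ?thesis
    using assms
    by (auto simp: is_1qcfa_def rot_qcfa_def tape_alphabet_def unitary_rot counter_next_def
        projective_measurement_coord_proj)
qed

lemma qcfa_run_rot_qcfa:
  assumes "d > 0" "q2 > 0"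
  shows "qcfa_run (rot_qcfa a q2 d \<kappa> \<theta>) (replicate n a) =
    (counter_state q2 n, rot d \<kappa> (real n * \<theta>) *\<^sub>v unit_vec d 0)"
proof -
  let ?A = "rot_qcfa a q2 d \<kappa> \<theta>"
  have letters: "foldl (qcfa_step ?A) (0, unit_vec d 0) (replicate n (Letter a)) =
      (counter_state q2 n, rot d \<kappa> (real n * \<theta>) *\<^sub>v unit_vec d 0)"
  proof (induction n)
    case 0
    show ?case by (simp add: counter_state_def rot_0)
  next
    case (Suc n)
    have "rot d \<kappa> \<theta> *\<^sub>v (rot d \<kappa> (real n * \<theta>) *\<^sub>v unit_vec d 0) =
        rot d \<kappa> (real (Suc n) * \<theta>) *\<^sub>v unit_vec d 0"
      by (subst assoc_mult_mat_vec[symmetric, of _ d d _ d])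
        (auto simp: rot_add distrib_right)
    then have "qcfa_step ?A (counter_state q2 n, rot d \<kappa> (real n * \<theta>) *\<^sub>v unit_vec d 0) (Letter a) =
        (counter_state q2 (Suc n), rot d \<kappa> (real (Suc n) * \<theta>) *\<^sub>v unit_vec d 0)"
      using assms(2) by (simp add: qcfa_step_def rot_qcfa_def counter_state_Suc)
    \<comment> \<open>\<open>foldl\<close> reads from the left, so the induction must split off the
      last letter.\<close>
    moreover have "replicate (Suc n) (Letter a) = replicate n (Letter a) @ [Letter a]"
      by (simp add: replicate_append_same)
    ultimately show ?case by (simp only: foldl_append foldl.simps Suc.IH)
  qed
  have "qcfa_step ?A (0, unit_vec d 0) LeftEnd = (0, unit_vec d 0)"
    by (simp add: qcfa_step_def rot_qcfa_def)
  moreover have "qcfa_step ?A (s, rot d \<kappa> \<phi> *\<^sub>v unit_vec d 0) RightEnd =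
      (s, rot d \<kappa> \<phi> *\<^sub>v unit_vec d 0)" for s \<phi>
    using mult_mat_vec_carrier[OF rot_carrier unit_vec_carrier, of d \<kappa> \<phi> 0]
    by (simp add: qcfa_step_def rot_qcfa_def)
  moreover have "cinit ?A = 0" "qdim ?A = d" "qinit ?A = 0"
    by (simp_all add: rot_qcfa_def)
  ultimately show ?thesis by (simp add: qcfa_run_def letters)
qed

section \<open>Acceptance probabilities and choice of parameters\<close>

text \<open>If the counter test fails, both outcomes lead to rejection, which then has probability
  \<open>P + (1 - P) = 1\<close>; errors can come only from the quantum test.\<close>

lemma prob_rot_qcfa:
  fixes a q2 d \<kappa> \<theta> n
  defines "A \<equiv> rot_qcfa a q2 d \<kappa> \<theta>"
    and "P \<equiv> (cmod ((\<Sum>l<d. cis (real n * \<theta> * \<kappa> l)) / of_nat d))\<^sup>2"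
  assumes "d > 0" "q2 > 0"
  shows "prob_accepts A (replicate n a) = (if n > 0 \<and> q2 dvd n then P else 0)"
    and "prob_rejects A (replicate n a) = (if n > 0 \<and> q2 dvd n then 1 - P else 1)"
proof -
  define \<psi> where "\<psi> = rot d \<kappa> (real n * \<theta>) *\<^sub>v unit_vec d 0"
  have \<psi>: "\<psi> \<in> carrier_vec d" unfolding \<psi>_def by (rule mult_mat_vec_carrier) auto
  have \<psi>_index: "\<psi> $ i = rot d \<kappa> (real n * \<theta>) $$ (i, 0)" if "i < d" for i
    using that assms(3) by (simp add: \<psi>_def)
  \<comment> \<open>On the diagonal the Fourier phases vanish, so the (0,0) entry of
    \<open>rot\<close> is the plain average of the phases.\<close>
  have P: "(cmod (\<psi> $ 0))\<^sup>2 = P"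
    using assms(3) by (simp add: \<psi>_index P_def rot_def)
  have "(\<Sum>i<d. (cmod (\<psi> $ i))\<^sup>2) = (\<Sum>i<d. (cmod (rot d \<kappa> (real n * \<theta>) $$ (i, 0)))\<^sup>2)"
    by (intro sum.cong) (auto simp: \<psi>_index)
  then have total: "(\<Sum>i<d. (cmod (\<psi> $ i))\<^sup>2) = 1" using unit_norm_rot_col assms(3) by simp
  have "{..<d} \<inter> {0} = {0}" using assms(3) by auto
  then have prob0: "outcome_prob (coord_proj d {0}) \<psi> = P"
    by (simp add: outcome_prob_coord_proj[OF \<psi>] P)
  have "(\<Sum>i<d. (cmod (\<psi> $ i))\<^sup>2) = (cmod (\<psi> $ 0))\<^sup>2 + (\<Sum>i\<in>{..<d} - {0}. (cmod (\<psi> $ i))\<^sup>2)"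
    using assms(3) by (intro sum.remove) auto
  then have prob1: "outcome_prob (coord_proj d (- {0})) \<psi> = 1 - P"
    using total P by (simp add: outcome_prob_coord_proj[OF \<psi>] Diff_eq)
  have run: "qcfa_run A (replicate n a) = (counter_state q2 n, \<psi>)"
    unfolding A_def \<psi>_def by (rule qcfa_run_rot_qcfa) fact+
  have meas: "qcfa_meas A s = [coord_proj d {0}, coord_proj d (- {0})]" for s
    by (simp add: A_def rot_qcfa_def)
  have final: "final_prob A F (replicate n a) =
      (if qcfa_final A (counter_state q2 n) 0 \<in> F then P else 0) +
      (if qcfa_final A (counter_state q2 n) 1 \<in> F then 1 - P else 0)" for F
  proof -
    let ?f = "qcfa_final A (counter_state q2 n)"
    have "{c. c < 2 \<and> ?f c \<in> F} = {c \<in> {0, 1}. ?f c \<in> F}" by (auto simp: less_2_cases_iff)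
    then have "final_prob A F (replicate n a) =
        (\<Sum>c | c \<in> {0, 1} \<and> ?f c \<in> F.
          outcome_prob ([coord_proj d {0}, coord_proj d (- {0})] ! c) \<psi>)"
      by (simp add: final_prob_def run meas numeral_2_eq_2)
    also have "\<dots> = (\<Sum>c\<in>{0, 1}. if ?f c \<in> F then
          outcome_prob ([coord_proj d {0}, coord_proj d (- {0})] ! c) \<psi> else 0)"
      by (rule sum.inter_filter) simp
    finally show ?thesis by (simp add: prob0 prob1)
  qed
  show "prob_accepts A (replicate n a) = (if n > 0 \<and> q2 dvd n then P else 0)"
    and "prob_rejects A (replicate n a) = (if n > 0 \<and> q2 dvd n then 1 - P else 1)"
    by (simp_all add: prob_accepts_def prob_rejects_def final)
      (auto simp: A_def rot_qcfa_def counter_state_eq_iff[OF \<open>q2 > 0\<close>])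
qed

text \<open>In the constant, \<open>24 / \<epsilon>\<close> comes from the Chernoff bound, while 3
  pays for rounding \<open>m\<close> up and for the \<open>q2 + 3\<close> classical states.\<close>

lemma exists_qcfa_mult_lang:
  fixes a :: 'a and \<epsilon> :: real and q1 q2 :: nat
  assumes \<epsilon>: "0 < \<epsilon>" "\<epsilon> \<le> 1" and q: "q1 \<ge> 2" "q2 \<ge> 2" and cop: "coprime q1 q2"
  shows "\<exists>A :: (nat, 'a) qcfa. is_1qcfa A \<and> alphabet A = {a} \<and>
    recognizes_one_sided A (mult_lang a (q1 * q2)) \<epsilon> \<and>
    real (qdim A) \<le> (24 / \<epsilon> + 3) * ln (real q1) \<and> real (card (cstates A)) \<le> (24 / \<epsilon> + 3) * real q2"
proof -
  \<comment> \<open>Chosen so that the bound \<open>2 * \<delta>^2\<close> on the squared average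
    equals \<open>\<epsilon>\<close>.\<close>
  define \<delta> where "\<delta> = sqrt (\<epsilon> / 2)"
  define b where "b = 4 * ln (4 * real q1) / \<delta>\<^sup>2"
  define m where "m = nat \<lceil>b\<rceil>"
  have \<delta>: "0 < \<delta>" "\<delta> \<le> 1" and \<delta>2: "\<delta>\<^sup>2 = \<epsilon> / 2" using \<epsilon> by (simp_all add: \<delta>_def)
  have "ln (4 * real q1) > 0" using q by simp
  then have "b > 0" using \<delta> by (simp add: b_def)
  then have m: "b \<le> real m" "real m \<le> b + 1" "m > 0" unfolding m_def by linarith+
  \<comment> \<open>Hence \<open>3 * ln q1 \<ge> 1\<close>, which absorbs the 1 lost in rounding
    \<open>b\<close> up.\<close>
  have ln_half: "1 / 2 \<le> ln (real q1)"
  proof -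
    have "exp (1 / 2 :: real) \<le> 2"
      using exp_half_le2 by simp
    then have "exp (1 / 2) \<le> real q1" using q by linarith
    then show ?thesis using q by (subst ln_ge_iff) auto
  qed
  \<comment> \<open>Uses \<open>4 \<le> q1^2\<close>, that is, \<open>q1 \<ge> 2\<close>.\<close>
  have "ln (4 * real q1) \<le> ln (real q1 ^ 3)"
    using q power_mono[of 2 "real q1" 2] by (subst ln_le_cancel_iff) (auto simp: power3_eq_cube power2_eq_square)
  then have ln4: "ln (4 * real q1) \<le> 3 * ln (real q1)" using q by (simp add: ln_realpow)
  have "b = 8 / \<epsilon> * ln (4 * real q1)" using \<epsilon> by (simp add: b_def \<delta>2)
  also have "\<dots> \<le> 8 / \<epsilon> * (3 * ln (real q1))" using ln4 \<epsilon> by (intro mult_left_mono) auto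
  finally have "b + 1 \<le> (24 / \<epsilon> + 3) * ln (real q1)" using ln_half by (simp add: distrib_right)
  then have dim: "real m \<le> (24 / \<epsilon> + 3) * ln (real q1)" using m by linarith
  obtain ks where ks: "length ks = m"
    and small: "\<And>n. \<not> q1 dvd n \<Longrightarrow>
      (cmod (\<Sum>k\<leftarrow>ks. cis (2 * pi * real k * real n / real q1)))\<^sup>2 \<le> 2 * (\<delta> * real m)\<^sup>2"
    using exists_small_exponential_sums[OF q(1) \<delta>, of m] m by (auto simp: b_def)
  define \<kappa> where "\<kappa> = (\<lambda>l. real (ks ! l))"
  define \<theta> where "\<theta> = 2 * pi / real q1"
  define P where "P n = (cmod ((\<Sum>l<m. cis (real n * \<theta> * \<kappa> l)) / of_nat m))\<^sup>2" for n
  define A where "A = rot_qcfa a q2 m \<kappa> \<theta>"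
  have P1: "P n = 1" if dvd: "q1 dvd n" for n
  proof -
    obtain j where j: "n = q1 * j" using dvd by auto
    have "cis (real n * \<theta> * \<kappa> l) = 1" for l
      using q cis_multiple_2pi[of "real (j * ks ! l)"] by (simp add: j \<theta>_def \<kappa>_def mult_ac)
    then show ?thesis using m by (simp add: P_def)
  qed
  have P2: "P n \<le> \<epsilon>" if ndvd: "\<not> q1 dvd n" for n
  proof -
    have "(\<Sum>l<m. cis (real n * \<theta> * \<kappa> l)) = (\<Sum>k\<leftarrow>ks. cis (2 * pi * real k * real n / real q1))"
      by (simp add: sum_list_sum_nth ks atLeast0LessThan \<theta>_def \<kappa>_def mult_ac)
    then show ?thesis
      using small[OF ndvd] m
      by (simp add: P_def norm_divide power_divide power_mult_distrib \<delta>2 divide_le_eq)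
  qed
  have acc: "prob_accepts A (replicate n a) = (if n > 0 \<and> q2 dvd n then P n else 0)"
    and rej: "prob_rejects A (replicate n a) = (if n > 0 \<and> q2 dvd n then 1 - P n else 1)" for n
    using prob_rot_qcfa[of m q2 a \<kappa> \<theta> n] m q by (simp_all add: A_def P_def)
  have rec: "recognizes_one_sided A (mult_lang a (q1 * q2)) \<epsilon>"
    unfolding recognizes_one_sided_def
  proof (intro conjI ballI)
    show "mult_lang a (q1 * q2) \<subseteq> lists (alphabet A)"
      by (auto simp: mult_lang_def A_def rot_qcfa_def)
  next
    fix w assume "w \<in> mult_lang a (q1 * q2)"
    then obtain k where "w = replicate (k * (q1 * q2)) a" "k \<ge> 1" by (auto simp: mult_lang_def)
    then show "prob_accepts A w = 1" using q by (simp add: acc P1)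
  next
    fix w assume w: "w \<in> lists (alphabet A) - mult_lang a (q1 * q2)"
    define n where "n = length w"
    have wn: "w = replicate n a"
      using w replicate_length_same[of w a] by (auto simp: n_def A_def rot_qcfa_def in_lists_conv_set)
    \<comment> \<open>If the counter test passes on a word outside the language, coprimality forces
      the quantum test to face a non-multiple of \<open>q1\<close>.\<close>
    have "\<not> q1 dvd n" if "n > 0" "q2 dvd n"
    proof
      assume "q1 dvd n"
      then have "q1 * q2 dvd n" using that cop by (simp add: divides_mult)
      then obtain k where "n = k * (q1 * q2)" by (metis dvd_def mult.commute)
      moreover from this have "k \<ge> 1" using \<open>n > 0\<close> by (cases k) auto
      ultimately have "w \<in> mult_lang a (q1 * q2)" by (auto simp: mult_lang_def wn)
      then show False using w by simp
    qed
    then show "prob_rejects A w \<ge> 1 - \<epsilon>" using P2 \<epsilon> by (auto simp: wn rej)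
  qed
  \<comment> \<open>There are \<open>q2 + 3\<close> states, and \<open>q2 \<ge> 2\<close>.\<close>
  have "real (card (cstates A)) \<le> 3 * real q2" using q by (simp add: A_def rot_qcfa_def)
  also have "\<dots> \<le> (24 / \<epsilon> + 3) * real q2" using \<epsilon> by (intro mult_right_mono) auto
  finally have "real (card (cstates A)) \<le> (24 / \<epsilon> + 3) * real q2" .
  moreover have "is_1qcfa A" unfolding A_def using m by (intro is_1qcfa_rot_qcfa)
  moreover have "alphabet A = {a}" "qdim A = m" by (simp_all add: A_def rot_qcfa_def)
  ultimately show ?thesis using rec dim by (intro exI[of _ A]) simp
qed

section \<open>From prime factorisations to coprime factors\<close>

text \<open>Nonempty parts of the partition keep \<open>q1\<close> and \<open>q2\<close> away from
  1; for \<open>q1 = 1\<close> the bound by a multiple of \<open>ln q1\<close> would leave no basis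
  state.\<close>

lemma prod_prime_powers_ge_2:
  fixes pr \<alpha> :: "'i \<Rightarrow> nat"
  assumes "finite I" "I \<noteq> {}" "\<And>i. i \<in> I \<Longrightarrow> prime (pr i) \<and> \<alpha> i \<ge> 1"
  shows "(\<Prod>i\<in>I. pr i ^ \<alpha> i) \<ge> 2"
proof -
  obtain i where i: "i \<in> I" using assms(2) by blast
  have "2 \<le> pr i" using assms(3)[OF i] prime_ge_2_nat by blast
  also have "\<dots> \<le> pr i ^ \<alpha> i" using assms(3)[OF i] \<open>2 \<le> pr i\<close> by (intro self_le_power) auto
  also have "\<dots> \<le> (\<Prod>i\<in>I. pr i ^ \<alpha> i)"
    using i assms prime_gt_0_nat by (intro dvd_imp_le dvd_prodI prod_pos) auto
  finally show ?thesis .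
qed

text \<open>\<open>C\<close> is quantified before the factorisation and the partition, so both
  bounds are uniform in them. The work is done by the coprime case.\<close>

theorem theorem14:
  fixes a :: 'a and \<epsilon> :: real
  assumes "0 < \<epsilon>" and "\<epsilon> \<le> 1/2"
  shows "\<exists>C>0::real. \<forall>(s::nat) (pr::nat \<Rightarrow> nat) (\<alpha>::nat \<Rightarrow> nat) (p::nat) (I1::nat set) (I2::nat set) (q1::nat) (q2::nat).
    s > 1 \<longrightarrow>
    (\<forall>i\<in>{1..s}. prime (pr i) \<and> \<alpha> i \<ge> 1) \<longrightarrow>
    inj_on pr {1..s} \<longrightarrow>
    p = (\<Prod>i=1..s. pr i ^ \<alpha> i) \<longrightarrow>
    I1 \<noteq> {} \<and> I2 \<noteq> {} \<and> I1 \<inter> I2 = {} \<and> I1 \<union> I2 = {1..s} \<longrightarrow>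
    q1 = (\<Prod>i\<in>I1. pr i ^ \<alpha> i) \<longrightarrow>
    q2 = (\<Prod>i\<in>I2. pr i ^ \<alpha> i) \<longrightarrow>
    ln (real q1) = (\<Sum>i\<in>I1. real (\<alpha> i) * ln (real (pr i))) \<and>
    (\<exists>A :: (nat, 'a) qcfa.
       is_1qcfa A \<and> alphabet A = {a} \<and>
       recognizes_one_sided A (mult_lang a p) \<epsilon> \<and>
       real (qdim A) \<le> C * ln (real q1) \<and>
       real (card (cstates A)) \<le> C * real q2)"
proof (intro exI[of _ "24 / \<epsilon> + 3"] conjI allI impI)
  show "0 < 24 / \<epsilon> + 3" using assms by (intro add_pos_pos) auto
next
  fix s p q1 q2 :: nat and pr \<alpha> :: "nat \<Rightarrow> nat" and I1 I2 :: "nat set"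
  assume pr: "\<forall>i\<in>{1..s}. prime (pr i) \<and> \<alpha> i \<ge> 1"
    and I: "I1 \<noteq> {} \<and> I2 \<noteq> {} \<and> I1 \<inter> I2 = {} \<and> I1 \<union> I2 = {1..s}"
    and q1: "q1 = (\<Prod>i\<in>I1. pr i ^ \<alpha> i)"
  have "pr i > 0" if "i \<in> I1" for i using that pr I prime_gt_0_nat by blast
  moreover have "finite I1" using I by (metis finite_Un finite_atLeastAtMost)
  ultimately show "ln (real q1) = (\<Sum>i\<in>I1. real (\<alpha> i) * ln (real (pr i)))"
    by (auto simp: q1 ln_prod ln_realpow intro!: sum.cong)
next
  fix s p q1 q2 :: nat and pr \<alpha> :: "nat \<Rightarrow> nat" and I1 I2 :: "nat set"
  assume pr: "\<forall>i\<in>{1..s}. prime (pr i) \<and> \<alpha> i \<ge> 1"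
    and inj: "inj_on pr {1..s}"
    and p: "p = (\<Prod>i=1..s. pr i ^ \<alpha> i)"
    and I: "I1 \<noteq> {} \<and> I2 \<noteq> {} \<and> I1 \<inter> I2 = {} \<and> I1 \<union> I2 = {1..s}"
    and q1: "q1 = (\<Prod>i\<in>I1. pr i ^ \<alpha> i)"
    and q2: "q2 = (\<Prod>i\<in>I2. pr i ^ \<alpha> i)"
  have fin: "finite I1" "finite I2" using I by (metis finite_Un finite_atLeastAtMost)+
  have sub: "I1 \<subseteq> {1..s}" "I2 \<subseteq> {1..s}" using I by auto
  have "q1 \<ge> 2" "q2 \<ge> 2"
    unfolding q1 q2 using fin sub pr I by (intro prod_prime_powers_ge_2; blast)+
  moreover have "coprime q1 q2"
    unfolding q1 q2
  proof (intro prod_coprime_left prod_coprime_right)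
    fix i j assume ij: "i \<in> I1" "j \<in> I2"
    \<comment> \<open>Disjointness of the parts gives \<open>i \<noteq> j\<close>, and injectivity
      of \<open>pr\<close> makes the primes distinct.\<close>
    then have "pr i \<noteq> pr j" using inj sub I by (metis disjoint_iff inj_onD subsetD)
    then have "coprime (pr i) (pr j)" using ij pr sub by (intro primes_coprime) blast+
    then show "coprime (pr i ^ \<alpha> i) (pr j ^ \<alpha> j)" by simp
  qed
  moreover have "p = q1 * q2"
    unfolding p q1 q2 using I fin by (metis prod.union_disjoint)
  ultimately show "\<exists>A :: (nat, 'a) qcfa.
       is_1qcfa A \<and> alphabet A = {a} \<and>
       recognizes_one_sided A (mult_lang a p) \<epsilon> \<and>
       real (qdim A) \<le> (24 / \<epsilon> + 3) * ln (real q1) \<and>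
       real (card (cstates A)) \<le> (24 / \<epsilon> + 3) * real q2"
    using exists_qcfa_mult_lang[of \<epsilon> q1 q2 a] assms by simp
qed

end
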